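(* Assume $n=(q^m-1)/(q-1)$, $n'=(q^{m-1}-1)/(q-1)$, $n''=q^{m-1}$. Let $(B_0,\ldots,B_{n''-1})$ be a partition of the Hamming space $H(n'-1,q)$ into $(n'-1,q^{n'-1-(m-1)},3)_q$ codes. Let $(D_0,\ldots,D_{n''-1})$ be a partition of the $(n'',q^{n''-1},2)_q$ MDS code $M_0$ into $n''$ codes with parameters $(n'',q^{n''-m},3)_q$, where $$M_a:=\{x_1\ldots x_{n''}:\ x_1+\ldots+x_{n''}\equiv a \bmod q\},\quad a\in\{0,\ldots,q-1\}.$$ \begin{itemize} \item[(i)] The code $S:=\bigcup_{i=0}^{q^{m-1}-1} D_iB_i$ is an $(n-1,q^{n-1-m},3)_q$ code. \item[(ii)] $S$ can be lengthened to a $1$-perfect $(n,q^{n-m},3)_q$ code if and only if every $B_i$ can be lengthened to a $1$-perfect $(n',q^{n'-(m-1)},3)_q$ code $C_i$ such that $C_0,\ldots,C_{q^{m-1}-1}$ form a partition of the Hamming space $H(n',q)$. \item[(iii)] There is a partition of $H(n-1,q)$ into $q^m$ codes $(n-1,q^{n-1-m},3)_q$, one of which is $S$. \end{itemize}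
   Context: $H(n,q)$ is the Hamming graph on the $n$-words over $\{0,1,\ldots,q-1\}$, adjacent words differing in exactly one position. An $(n,M,d)_q$-code is a set of $M$ vertices with minimum Hamming distance $d$; MDS codes attain $M=q^{n-d+1}$. For codes $C$, $D$, $CD:=\{\mathbf{x}\mathbf{y}:\ \mathbf{x}\in C,\ \mathbf{y}\in D\}$ (concatenation). A code $C^-$ obtained from $C$ by taking the codewords with a fixed symbol in position $j$ and deleting position $j$ is a shortened $C$, and $C$ is then a lengthened $C^-$. A $1$-perfect code is a set of vertices such that every vertex is at distance $0$ or $1$ from exactly one element of it. *)

theory Defs
  imports Main "HOL-Library.Disjoint_Sets"
begin

definition words :: "nat \<Rightarrow> nat \<Rightarrow> nat list set" where
  "words q n = {x. length x = n \<and> set x \<subseteq> {..<q}}"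

text \<open>Used only for words of equal length, where it is the graph distance of \<open>H(n,q)\<close>.\<close>

definition hdist :: "nat list \<Rightarrow> nat list \<Rightarrow> nat" where
  "hdist x y = card {i. i < length x \<and> x ! i \<noteq> y ! i}"

text \<open>
  \<open>code q n M d C\<close>: \<open>C\<close> is an \<open>(n,M,d)\<^sub>q\<close> code in the strict sense, the minimum distance being
  attained and equal to \<open>d\<close>. \<open>code_ge\<close> is the usual relaxed variant with minimum distance at
  least \<open>d\<close> (no condition if there is only one codeword). The relaxed variant is
  needed for families of codes given as data: for \<open>q = 2\<close> the code \<open>M\<^sub>0\<close> consists of the
  even-weight words, so codes inside it can never have minimum distance exactly 3, and
  codes of length 2 with a single codeword occur.
\<close>

definition code_ge :: "nat \<Rightarrow> nat \<Rightarrow> nat \<Rightarrow> nat \<Rightarrow> nat list set \<Rightarrow> bool" where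
  "code_ge q n M d C \<longleftrightarrow>
     C \<subseteq> words q n \<and> card C = M \<and> (\<forall>x\<in>C. \<forall>y\<in>C. x \<noteq> y \<longrightarrow> d \<le> hdist x y)"

definition code :: "nat \<Rightarrow> nat \<Rightarrow> nat \<Rightarrow> nat \<Rightarrow> nat list set \<Rightarrow> bool" where
  "code q n M d C \<longleftrightarrow>
     code_ge q n M d C \<and> (\<exists>x\<in>C. \<exists>y\<in>C. x \<noteq> y \<and> hdist x y = d)"

definition one_perfect :: "nat \<Rightarrow> nat \<Rightarrow> nat list set \<Rightarrow> bool" where
  "one_perfect q n C \<longleftrightarrow> C \<subseteq> words q n \<and> (\<forall>v\<in>words q n. \<exists>!c. c \<in> C \<and> hdist v c \<le> 1)"

definition sum_code :: "nat \<Rightarrow> nat \<Rightarrow> nat \<Rightarrow> nat list set" where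
  "sum_code q n a = {x \<in> words q n. sum_list x mod q = a}"

definition concat_code :: "nat list set \<Rightarrow> nat list set \<Rightarrow> nat list set" where
  "concat_code C D = {x @ y |x y. x \<in> C \<and> y \<in> D}"

text \<open>Positions are counted from 0; the result shortens \<open>C\<close> in position \<open>j\<close> by the symbol \<open>a\<close>.
  When a whole partition is lengthened to a partition, \<open>j\<close> and \<open>a\<close> must be common to all its
  cells: with positions varying from cell to cell the equivalence in the theorem fails already
  for \<open>q = 4\<close>, \<open>m = 3\<close>.\<close>

definition shortened :: "nat \<Rightarrow> nat \<Rightarrow> nat list set \<Rightarrow> nat list set" where
  "shortened j a C = {take j x @ drop (Suc j) x |x. x \<in> C \<and> x ! j = a}"

text \<open>Cells carry an index; distinct indices have disjoint cells.\<close>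

definition indexed_partition :: "nat \<Rightarrow> (nat \<Rightarrow> 'a set) \<Rightarrow> 'a set \<Rightarrow> bool" where
  "indexed_partition k P A \<longleftrightarrow> (\<Union>i<k. P i) = A \<and> disjoint_family_on P {..<k}"

end

theory Submission
  imports Defs "HOL-Number_Theory.Cong"
begin

text \<open>A word outside the zero-sum code has exactly one neighbour in each cell \<open>D\<^sub>i\<close>. Hence gluing
  perfect codes that partition \<open>H(n',q)\<close> along the \<open>D\<^sub>i\<close> gives a perfect code. Conversely, if a
  perfect code \<open>C\<close> shortens to \<open>S\<close>, then every codeword restricts to a zero-sum word on the first
  \<open>n''\<close> coordinates of \<open>S\<close> (otherwise it would be within distance 2 of a codeword lengthening \<open>S\<close>).
  As two zero-sum words are never adjacent, the fibre of \<open>C\<close> over any zero-sum word is perfect.\<close>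

section \<open>Hamming distance and words\<close>

text \<open>The perfection arguments share one account: a covering codeword may differ from the
  given word in at most one coordinate. A zero-sum prefix cannot spend that change and remain
  zero-sum, while any other prefix must spend it, so each word leaves only one factor to correct. In
  the converse the deleted coordinate may lie anywhere, even among the first \<open>n''\<close>
  positions. Codewords are therefore written \<open>ins j s (x @ y)\<close>: the prefix
  \<open>x\<close> and suffix \<open>y\<close> refer to coordinates of \<open>S\<close>, and the
  inserted symbol \<open>s\<close> is carried separately. Since \<open>code\<close> asks for an
  attained distance, every parameter claim needs, besides a count and a lower bound, a pair of
  codewords at distance exactly 3.\<close>

lemma hdist_sum: "hdist x y = (\<Sum>i<length x. of_bool (x ! i \<noteq> y ! i))"
proof -
  have "{i. i < length x \<and> x ! i \<noteq> y ! i} = {..<length x} \<inter> {i. x ! i \<noteq> y ! i}"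
    by auto
  then show ?thesis
    by (simp add: hdist_def)
qed

lemma hdist_Nil [simp]: "hdist [] y = 0"
  by (simp add: hdist_def)

lemma hdist_Cons [simp]: "hdist (a # x) (b # y) = of_bool (a \<noteq> b) + hdist x y"
  by (simp add: hdist_sum sum.lessThan_Suc_shift del: sum.lessThan_Suc)

lemma hdist_append:
  "length x = length x' \<Longrightarrow> hdist (x @ y) (x' @ y') = hdist x x' + hdist y y'"
  by (induction x x' rule: list_induct2) auto

lemma hdist_same [simp]: "hdist x x = 0"
  by (simp add: hdist_def)

lemma hdist_eq_0_iff: "length x = length y \<Longrightarrow> hdist x y = 0 \<longleftrightarrow> x = y"
  by (induction x y rule: list_induct2) auto

lemma hdist_commute: "length x = length y \<Longrightarrow> hdist x y = hdist y x"
  by (induction x y rule: list_induct2) auto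

lemma hdist_triangle:
  "length x = length y \<Longrightarrow> length y = length z \<Longrightarrow> hdist x z \<le> hdist x y + hdist y z"
  by (induction x y z rule: list_induct3) auto

lemma words_length: "x \<in> words q n \<Longrightarrow> length x = n"
  by (simp add: words_def)

lemma words_append_iff:
  "length x = n \<Longrightarrow> x @ y \<in> words q (n + l) \<longleftrightarrow> x \<in> words q n \<and> y \<in> words q l"
  by (auto simp: words_def)

lemma words_split:
  assumes "w \<in> words q (n + l)"
  obtains x y where "x \<in> words q n" "y \<in> words q l" "w = x @ y"
proof
  show "w = take n w @ drop n w" by simp
  show "take n w \<in> words q n" "drop n w \<in> words q l"
    using assms set_take_subset[of n w] set_drop_subset[of n w] by (auto simp: words_def)
qed

lemma words_Cons_iff: "s # y \<in> words q (Suc n) \<longleftrightarrow> s < q \<and> y \<in> words q n"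
  by (auto simp: words_def)

lemma words_nth_less: "x \<in> words q n \<Longrightarrow> p < n \<Longrightarrow> x ! p < q"
  by (auto simp: words_def dest: nth_mem)

lemma words_update: "x \<in> words q n \<Longrightarrow> s < q \<Longrightarrow> x[p := s] \<in> words q n"
  using set_update_subset_insert[of x p s] by (auto simp: words_def)

lemma finite_words: "finite (words q n)"
  using finite_lists_length_eq[of "{..<q}" n] by (simp add: words_def conj_commute)

lemma card_words: "card (words q n) = q ^ n"
  using card_lists_length_eq[of "{..<q}" n] by (simp add: words_def conj_commute)

lemma hdist_update_le: "hdist x (x[p := s]) \<le> 1"
proof -
  have "{i. i < length x \<and> x ! i \<noteq> x[p := s] ! i} \<subseteq> {p}"
  proof clarsimp
    fix i
    assume "x ! i \<noteq> x[p := s] ! i"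
    then show "i = p"
      by (metis nth_list_update_neq)
  qed
  then show ?thesis
    using card_mono[of "{p}"] by (simp add: hdist_def)
qed

lemma hdist_update_towards:
  assumes "length x = length y" "p < length x" "x ! p \<noteq> y ! p"
  shows "hdist x y = Suc (hdist (x[p := y ! p]) y)"
proof -
  let ?A = "{i. i < length x \<and> x ! i \<noteq> y ! i}"
  have "{i. i < length (x[p := y ! p]) \<and> x[p := y ! p] ! i \<noteq> y ! i} = ?A - {p}"
    using assms by (auto simp: nth_list_update split: if_splits)
  moreover have "card ?A = Suc (card (?A - {p}))"
    by (rule card.remove) (use assms in auto)
  ultimately show ?thesis
    by (simp add: hdist_def)
qed

lemma words_neq_obtain:
  assumes "x \<in> words q n" "y \<in> words q n" "x \<noteq> y"
  obtains p where "p < n" "x ! p \<noteq> y ! p"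
  using assms by (metis nth_equalityI words_length)

text \<open>Moving one differing coordinate of \<open>x\<close> to its value in \<open>y\<close>
  leaves at most one difference. Hence radius-1 balls around words at distance at most 2 overlap,
  which is what forces minimum distance 3 on perfect codes.\<close>

lemma hdist_midpoint:
  assumes "x \<in> words q n" "y \<in> words q n" "hdist x y \<le> 2"
  obtains v where "v \<in> words q n" "hdist v x \<le> 1" "hdist v y \<le> 1"
proof (cases "x = y")
  case True
  then show ?thesis using that[of x] assms by simp
next
  case False
  then obtain p where p: "p < n" "x ! p \<noteq> y ! p"
    using words_neq_obtain assms by metis
  show ?thesis
  proof (rule that)
    show "x[p := y ! p] \<in> words q n"
      using assms p by (auto intro: words_update words_nth_less)
    show "hdist (x[p := y ! p]) x \<le> 1"
      using hdist_update_le[of x p] by (simp add: hdist_commute)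
    show "hdist (x[p := y ! p]) y \<le> 1"
      using hdist_update_towards[of x y p] assms p by (simp add: words_length)
  qed
qed

section \<open>Adding a constant to one coordinate\<close>

text \<open>Symbols are read as residues modulo \<open>q\<close>. With \<open>p\<close> and
  \<open>e\<close> fixed this is an isometry shifting the coordinate sum by \<open>e\<close>; with
  the word fixed and \<open>0 < e < q\<close>, varying \<open>p\<close> and \<open>e\<close> lists
  its neighbours. Both views are used below.\<close>

definition bump :: "nat \<Rightarrow> nat \<Rightarrow> nat \<Rightarrow> nat list \<Rightarrow> nat list" where
  "bump q p e x = x[p := (x ! p + e) mod q]"

lemma bump_words: "x \<in> words q n \<Longrightarrow> 0 < q \<Longrightarrow> bump q p e x \<in> words q n"
  by (simp add: bump_def words_update)

lemma length_bump [simp]: "length (bump q p e x) = length x"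
  by (simp add: bump_def)

lemma hdist_bump_le: "hdist x (bump q p e x) \<le> 1"
  unfolding bump_def by (rule hdist_update_le)

lemma hdist_bump_le': "hdist (bump q p e x) x \<le> 1"
  using hdist_bump_le[of x q p e] by (simp add: hdist_commute)

lemma sum_bump:
  assumes "p < length x"
  shows "[sum_list (bump q p e x) = sum_list x + e] (mod q)"
proof -
  have "sum_list (bump q p e x) + x ! p = sum_list x + (x ! p + e) mod q"
    using assms member_le_sum_list[of "x ! p" x] by (simp add: bump_def sum_list_update)
  then have "[sum_list (bump q p e x) + x ! p = sum_list x + e + x ! p] (mod q)"
    by (simp add: cong_def mod_add_right_eq add_ac)
  then show ?thesis
    by (simp only: cong_add_rcancel_nat)
qed

lemma bump_cancel:
  assumes "x \<in> words q n" "[e + e' = 0] (mod q)" "p < n"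
  shows "bump q p e (bump q p e' x) = x"
proof -
  have "(x ! p + e' + e) mod q = x ! p mod q"
    using cong_add[OF cong_refl[of "x ! p"] assms(2)] by (simp add: cong_def add_ac)
  also have "\<dots> = x ! p"
    using words_nth_less[OF assms(1,3)] by simp
  finally show ?thesis
    using assms by (simp add: bump_def words_length mod_simps)
qed

lemma bump_nth_neq:
  assumes "x \<in> words q n" "p < n" "0 < e" "e < q"
  shows "bump q p e x ! p \<noteq> x ! p"
proof
  assume "bump q p e x ! p = x ! p"
  then have "[x ! p + e = x ! p] (mod q)"
    using assms words_nth_less[OF assms(1,2)] by (simp add: bump_def words_length cong_def)
  then have "q dvd e"
    by (simp add: cong_add_lcancel_0_nat cong_0_iff)
  then show False
    using assms by (auto dest: dvd_imp_le)
qed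

lemma hdist_bump_bump:
  assumes "x \<in> words q n" "y \<in> words q n" "p < n"
  shows "hdist (bump q p e x) (bump q p e y) = hdist x y"
proof -
  have "(x ! p + e) mod q = (y ! p + e) mod q \<longleftrightarrow> x ! p = y ! p"
    using cong_add_rcancel_nat[of "x ! p" e "y ! p" q] words_nth_less[OF assms(1,3)]
      words_nth_less[OF assms(2,3)] by (simp add: cong_def)
  then have "{i. i < length (bump q p e x) \<and> bump q p e x ! i \<noteq> bump q p e y ! i} =
             {i. i < length x \<and> x ! i \<noteq> y ! i}"
    using assms by (auto simp: bump_def words_length nth_list_update)
  then show ?thesis
    by (simp add: hdist_def)
qed

lemma inj_on_bump:
  assumes "p < n"
  shows "inj_on (bump q p e) (words q n)"
proof (rule inj_onI)
  fix x y
  assume *: "x \<in> words q n" "y \<in> words q n" "bump q p e x = bump q p e y"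
  then have "hdist x y = 0"
    using hdist_bump_bump[of x q n y p e] assms by simp
  then show "x = y"
    using * by (simp add: hdist_eq_0_iff words_length)
qed

section \<open>Perfect codes\<close>

lemma ball_eq_bumps:
  assumes q: "2 \<le> q" and c: "c \<in> words q n"
  shows "{v \<in> words q n. hdist v c \<le> 1} =
         insert c ((\<lambda>(p, e). bump q p e c) ` ({..<n} \<times> {1..<q}))"
proof (intro equalityI subsetI)
  fix v
  assume "v \<in> {v \<in> words q n. hdist v c \<le> 1}"
  then have v: "v \<in> words q n" "hdist v c \<le> 1" by auto
  show "v \<in> insert c ((\<lambda>(p, e). bump q p e c) ` ({..<n} \<times> {1..<q}))"
  proof (cases "v = c")
    case False
    then obtain p where p: "p < n" "c ! p \<noteq> v ! p"
      using words_neq_obtain c v(1) by metis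
    have "hdist (c[p := v ! p]) v = 0"
      using hdist_update_towards[of c v p] p c v hdist_commute[of v c] by (simp add: words_length)
    then have veq: "v = c[p := v ! p]"
      using hdist_eq_0_iff[of "c[p := v ! p]" v] c v by (simp add: words_length)
    \<comment> \<open>This is the residue of \<open>v ! p - c ! p\<close> modulo \<open>q\<close>;
      the case split avoids truncated subtraction.\<close>
    define e where "e = (if c ! p < v ! p then v ! p - c ! p else v ! p + q - c ! p)"
    have lt: "c ! p < q" "v ! p < q"
      using words_nth_less c v p by auto
    have "(c ! p + e) mod q = v ! p" and e: "e \<in> {1..<q}"
      using lt p(2) by (auto simp: e_def)
    then have "v = bump q p e c"
      using veq by (metis bump_def)
    with e show ?thesis
      using p(1) by (intro insertI2 image_eqI[of _ _ "(p, e)"]) auto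
  qed simp
next
  fix v
  assume "v \<in> insert c ((\<lambda>(p, e). bump q p e c) ` ({..<n} \<times> {1..<q}))"
  then show "v \<in> {v \<in> words q n. hdist v c \<le> 1}"
    using c q bump_words[OF c] hdist_bump_le' by (auto simp del: One_nat_def)
qed

text \<open>A neighbour of \<open>c\<close> reveals the changed position and then the difference
  modulo \<open>q\<close>, so the pairs \<open>(p, e)\<close> count the neighbours without
  repetition; the summand 1 is \<open>c\<close> itself.\<close>

lemma card_ball:
  assumes q: "2 \<le> q" and c: "c \<in> words q n"
  shows "card {v \<in> words q n. hdist v c \<le> 1} = 1 + n * (q - 1)"
proof -
  let ?f = "\<lambda>(p, e). bump q p e c"
  have len: "length c = n"
    using c by (rule words_length)
  have inj: "inj_on ?f ({..<n} \<times> {1..<q})"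
  proof (rule inj_onI, clarify)
    fix p e p' e'
    assume *: "p < n" "e \<in> {1..<q}" "p' < n" "e' \<in> {1..<q}" "bump q p e c = bump q p' e' c"
    have "p = p'"
      using * bump_nth_neq[OF c, of p e] len by (auto simp: bump_def nth_list_update split: if_splits)
    moreover from this have "(c ! p + e) mod q = (c ! p + e') mod q"
      using * len by (auto simp: bump_def dest: arg_cong[where f = "\<lambda>x. x ! p"])
    then have "[e = e'] (mod q)"
      using cong_add_lcancel_nat[of "c ! p" e e' q] by (simp add: cong_def)
    then have "e = e'"
      using * by (simp add: cong_def)
    ultimately show "p = p' \<and> e = e'" by simp
  qed
  have "c \<noteq> bump q p e c" if "p < n" "e \<in> {1..<q}" for p e
    using bump_nth_neq[OF c, of p e] that by auto
  then have "c \<notin> ?f ` ({..<n} \<times> {1..<q})"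
    by (simp add: image_iff split_paired_Ball_Sigma)
  then show ?thesis
    using inj unfolding ball_eq_bumps[OF q c] by (simp add: card_image)
qed

lemma one_perfectD:
  assumes "one_perfect q n C"
  shows "C \<subseteq> words q n"
    and "v \<in> words q n \<Longrightarrow> \<exists>c\<in>C. hdist v c \<le> 1"
    and "v \<in> words q n \<Longrightarrow> c \<in> C \<Longrightarrow> c' \<in> C \<Longrightarrow> hdist v c \<le> 1 \<Longrightarrow> hdist v c' \<le> 1 \<Longrightarrow> c = c'"
  using assms unfolding one_perfect_def by blast+

lemma one_perfect_hdist_ge:
  assumes "one_perfect q n C" "c \<in> C" "c' \<in> C" "c \<noteq> c'"
  shows "3 \<le> hdist c c'"
proof (rule ccontr)
  assume "\<not> 3 \<le> hdist c c'"
  then have le: "hdist c c' \<le> 2"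
    by simp
  have "c \<in> words q n" "c' \<in> words q n"
    using one_perfectD(1)[OF assms(1)] assms by blast+
  then obtain v where "v \<in> words q n" "hdist v c \<le> 1" "hdist v c' \<le> 1"
    using le by (rule hdist_midpoint)
  then show False
    using one_perfectD(3)[OF assms(1)] assms by blast
qed

text \<open>Uniqueness of the covering codeword is free: two codewords within 1 of the same word
  would be within 2 of each other.\<close>

lemma one_perfectI:
  assumes "C \<subseteq> words q n"
    and dist: "\<And>c c'. c \<in> C \<Longrightarrow> c' \<in> C \<Longrightarrow> c \<noteq> c' \<Longrightarrow> 3 \<le> hdist c c'"
    and cover: "\<And>v. v \<in> words q n \<Longrightarrow> \<exists>c\<in>C. hdist v c \<le> 1"
  shows "one_perfect q n C"
  unfolding one_perfect_def
proof (intro conjI ballI)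
  fix v
  assume v: "v \<in> words q n"
  obtain c where c: "c \<in> C" "hdist v c \<le> 1"
    using cover v by blast
  have "c' = c" if c': "c' \<in> C" "hdist v c' \<le> 1" for c'
  proof (rule ccontr)
    assume "c' \<noteq> c"
    have len: "length c = length v" "length c' = length v"
      using assms(1) c c' v by (metis subsetD words_length)+
    have "3 \<le> hdist c' c"
      using dist c c' \<open>c' \<noteq> c\<close> by blast
    moreover have "hdist c' c \<le> hdist c' v + hdist v c"
      using len by (intro hdist_triangle) simp_all
    moreover have "hdist c' v = hdist v c'"
      using len by (intro hdist_commute)
    ultimately show False
      using c c' by simp
  qed
  then show "\<exists>!c. c \<in> C \<and> hdist v c \<le> 1"
    using c by blast
qed (use assms in blast)

text \<open>The second equation is the ball size: for length \<open>(q ^ k - 1) div (q - 1)\<close>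
  a radius-1 ball has exactly \<open>q ^ k\<close> words. It also shows that the division is
  exact.\<close>

lemma geometric_div:
  fixes q k :: nat
  assumes "2 \<le> q"
  shows "(q ^ k - 1) div (q - 1) = (\<Sum>i<k. q ^ i)"
    and "1 + (\<Sum>i<k. q ^ i) * (q - 1) = q ^ k"
proof -
  show *: "1 + (\<Sum>i<k. q ^ i) * (q - 1) = q ^ k"
  proof (induction k)
    case (Suc k)
    have "1 + (\<Sum>i<Suc k. q ^ i) * (q - 1) = q ^ k + q ^ k * (q - 1)"
      using Suc.IH by (simp add: algebra_simps)
    also have "\<dots> = q ^ Suc k"
      using assms by (cases q) simp_all
    finally show ?case .
  qed simp
  show "(q ^ k - 1) div (q - 1) = (\<Sum>i<k. q ^ i)"
    using assms by (simp flip: *)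
qed

text \<open>The balls around the codewords tile the space, which gives the size. For the attained
  distance, a word at distance 2 from a codeword must be covered by another codeword, and that one
  is at distance at most 3 from the first.\<close>

lemma code_of_one_perfect:
  assumes q: "2 \<le> q" and n: "n = (q ^ k - 1) div (q - 1)" "2 \<le> n" and C: "one_perfect q n C"
  shows "code q n (q ^ (n - k)) 3 C"
proof -
  note CD = one_perfectD[OF C]
  have fin: "finite C"
    using CD(1) finite_words finite_subset by blast
  have ball: "1 + n * (q - 1) = q ^ k"
    using geometric_div[OF q, of k] n by simp
  have "words q n = (\<Union>c\<in>C. {v \<in> words q n. hdist v c \<le> 1})"
    using CD(2) by blast
  then have "q ^ n = card (\<Union>c\<in>C. {v \<in> words q n. hdist v c \<le> 1})"
    by (simp flip: card_words)
  also have "\<dots> = (\<Sum>c\<in>C. card {v \<in> words q n. hdist v c \<le> 1})"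
    using CD(3) by (intro card_UN_disjoint fin) (auto simp: finite_words)
  also have "\<dots> = card C * q ^ k"
    using CD(1) card_ball[OF q] ball by (simp add: subset_iff)
  finally have eq: "q ^ n = card C * q ^ k" .
  \<comment> \<open>The bound \<open>k \<le> n\<close> makes the exponent \<open>n - k\<close> a
    genuine difference.\<close>
  then have "q ^ k \<le> q ^ n"
    using q by (cases "card C") auto
  then have "k \<le> n"
    using q power_le_imp_le_exp[of q k n] by simp
  then have "q ^ n = q ^ (n - k) * q ^ k"
    by (simp flip: power_add)
  then have card: "card C = q ^ (n - k)"
    using eq q by simp
  then obtain c where c: "c \<in> C"
    using q by fastforce
  have cw: "c \<in> words q n"
    using c CD(1) by blast
  \<comment> \<open>Changing coordinates 0 and 1 gives distance exactly 2 from \<open>c\<close>;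
    this is where length at least 2 is needed.\<close>
  define v where "v = bump q 1 1 (bump q 0 1 c)"
  have v: "v \<in> words q n"
    using cw q by (simp add: v_def bump_words)
  then obtain c' where c': "c' \<in> C" "hdist v c' \<le> 1"
    using CD(2) by blast
  have c'w: "c' \<in> words q n"
    using c' CD(1) by blast
  have cv: "hdist c v \<le> 2"
    using hdist_triangle[of c "bump q 0 1 c" v] hdist_bump_le[of c q 0 1]
      hdist_bump_le[of "bump q 0 1 c" q 1 1] by (simp add: v_def)
  have "hdist c v = 2"
  proof -
    have "v ! 0 \<noteq> c ! 0" "v ! 1 \<noteq> c ! 1"
      using bump_nth_neq[OF cw, of 0 1] bump_nth_neq[OF cw, of 1 1] q n(2) cw
      by (auto simp: v_def bump_def words_length)
    then have "{0, 1} \<subseteq> {i. i < length c \<and> c ! i \<noteq> v ! i}"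
      using words_length[OF cw] n(2) by auto
    then have "card {0, 1 :: nat} \<le> hdist c v"
      unfolding hdist_def by (intro card_mono) auto
    then show ?thesis
      using cv by simp
  qed
  then have "c \<noteq> c'"
    using c' hdist_commute[of c v] v cw by (auto simp: words_length)
  moreover have "hdist c c' \<le> 3"
    using hdist_triangle[of c v c'] cv c' v cw c'w by (simp add: words_length)
  ultimately have "hdist c c' = 3"
    using one_perfect_hdist_ge[OF C c c'(1)] by simp
  then show ?thesis
    using c c' CD(1) card \<open>c \<noteq> c'\<close> one_perfect_hdist_ge[OF C]
    unfolding code_def code_ge_def by blast
qed

section \<open>Inserting a coordinate\<close>

definition ins :: "nat \<Rightarrow> nat \<Rightarrow> nat list \<Rightarrow> nat list" where
  "ins j s w = take j w @ s # drop j w"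

lemma hdist_ins:
  assumes "length w = length w'"
  shows "hdist (ins j s w) (ins j t w') = of_bool (s \<noteq> t) + hdist w w'"
proof -
  have "hdist (take j w @ drop j w) (take j w' @ drop j w') =
        hdist (take j w) (take j w') + hdist (drop j w) (drop j w')"
    using assms by (intro hdist_append) simp
  then show ?thesis
    using assms by (simp add: ins_def hdist_append)
qed

lemma ins_words: "w \<in> words q n \<Longrightarrow> s < q \<Longrightarrow> ins j s w \<in> words q (Suc n)"
  using set_take_subset[of j w] set_drop_subset[of j w] by (auto simp: words_def ins_def)

lemma words_ins_cases:
  assumes "c \<in> words q (Suc n)" "j \<le> n"
  obtains s w where "s < q" "w \<in> words q n" "c = ins j s w"
proof
  have len: "length c = Suc n"
    using assms by (simp add: words_length)
  show "c ! j < q"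
    using assms by (simp add: words_nth_less)
  show "take j c @ drop (Suc j) c \<in> words q n"
    using assms set_take_subset[of j c] set_drop_subset[of "Suc j" c] by (auto simp: words_def)
  show "c = ins j (c ! j) (take j c @ drop (Suc j) c)"
    using assms(2) len by (simp add: ins_def id_take_nth_drop[symmetric])
qed

text \<open>Deleting position \<open>j\<close> is undone by \<open>ins\<close>, so shortening
  becomes a membership test. The ambient length forces \<open>w\<close> to have length
  \<open>n\<close>, hence position \<open>j\<close> of \<open>ins j a w\<close> is the inserted
  one.\<close>

lemma shortened_iff:
  assumes C: "C \<subseteq> words q (Suc n)" and j: "j \<le> n"
  shows "w \<in> shortened j a C \<longleftrightarrow> ins j a w \<in> C"
proof
  assume "w \<in> shortened j a C"
  then obtain x where x: "x \<in> C" "x ! j = a" "w = take j x @ drop (Suc j) x"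
    by (auto simp: shortened_def)
  then have "length x = Suc n"
    using C by (auto dest: words_length)
  then have "take j x @ x ! j # drop (Suc j) x = x"
    using j by (intro id_take_nth_drop[symmetric]) simp
  then have "ins j a w = x"
    using x j \<open>length x = Suc n\<close> by (simp add: ins_def)
  then show "ins j a w \<in> C"
    using x by simp
next
  assume *: "ins j a w \<in> C"
  then have "length (ins j a w) = Suc n"
    using C by (auto dest: words_length)
  then have "length w = n"
    by (auto simp: ins_def)
  then have "ins j a w ! j = a" "take j (ins j a w) @ drop (Suc j) (ins j a w) = w"
    using j by (simp_all add: ins_def nth_append)
  then show "w \<in> shortened j a C"
    using * unfolding shortened_def by force
qed

section \<open>Partitions of the zero-sum code\<close>

lemma indexed_partition_inD:
  assumes "indexed_partition k P A"
  shows "x \<in> A \<Longrightarrow> \<exists>i<k. x \<in> P i"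
    and "i < k \<Longrightarrow> x \<in> P i \<Longrightarrow> x \<in> A"
    and "i < k \<Longrightarrow> i' < k \<Longrightarrow> x \<in> P i \<Longrightarrow> x \<in> P i' \<Longrightarrow> i = i'"
  using assms by (auto simp: indexed_partition_def disjoint_family_on_def)

lemma indexed_partitionI:
  assumes "\<And>i x. i < k \<Longrightarrow> x \<in> P i \<Longrightarrow> x \<in> A"
    and "\<And>x. x \<in> A \<Longrightarrow> \<exists>i<k. x \<in> P i"
    and "\<And>i i' x. i < k \<Longrightarrow> i' < k \<Longrightarrow> x \<in> P i \<Longrightarrow> x \<in> P i' \<Longrightarrow> i = i'"
  shows "indexed_partition k P A"
  unfolding indexed_partition_def disjoint_family_on_def
proof (intro conjI ballI impI)
  show "(\<Union>i<k. P i) = A"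
    using assms(1,2) by (auto simp: Bex_def)
  show "P i \<inter> P i' = {}" if "i \<in> {..<k}" "i' \<in> {..<k}" "i \<noteq> i'" for i i'
    using assms(3)[of i i'] that by auto
qed

lemma sum_code_words: "x \<in> sum_code q n a \<Longrightarrow> x \<in> words q n"
  by (simp add: sum_code_def)

text \<open>Replacing a single symbol by a different one below \<open>q\<close> changes the sum
  modulo \<open>q\<close>.\<close>

lemma sum_code_hdist:
  assumes "x \<in> sum_code q n a" "y \<in> sum_code q n a" "hdist x y \<le> 1"
  shows "x = y"
proof -
  have "length x = length y"
    using assms by (auto simp: sum_code_def words_length)
  \<comment> \<open>The induction uses congruence of the two sums: dropping a common first symbol
    preserves it, whereas the residue \<open>a\<close> itself would change.\<close>
  moreover have "set x \<subseteq> {..<q}" "set y \<subseteq> {..<q}" "[sum_list x = sum_list y] (mod q)"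
    using assms by (auto simp: sum_code_def words_def cong_def)
  ultimately show ?thesis
    using assms(3)
  proof (induction x y rule: list_induct2)
    case (Cons b x c y)
    show ?case
    proof (cases "b = c")
      case True
      then show ?thesis
        using Cons by (simp add: cong_add_lcancel_nat)
    next
      case False
      then have "x = y"
        using Cons.prems Cons.hyps by (simp add: hdist_eq_0_iff)
      then have "[b = c] (mod q)"
        using Cons.prems by (simp add: cong_add_rcancel_nat)
      then show ?thesis
        using Cons.prems False by (simp add: cong_def)
    qed
  qed simp
qed

text \<open>The word length and the number of cells are the same \<open>N\<close>, which is what the
  pigeonhole argument of \<open>D_covers\<close> rests on. That \<open>N\<close> is a power of
  \<open>q\<close> enters only in the parameters computed in the theorem.\<close>

locale zero_sum_partition =
  fixes q N :: nat and D :: "nat \<Rightarrow> nat list set"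
  assumes q: "2 \<le> q" and N: "0 < N"
    and partition: "indexed_partition N D (sum_code q N 0)"
    and dist: "\<And>i x y. i < N \<Longrightarrow> x \<in> D i \<Longrightarrow> y \<in> D i \<Longrightarrow> x \<noteq> y \<Longrightarrow> 3 \<le> hdist x y"
begin

lemmas D_ex = indexed_partition_inD(1)[OF partition]
lemmas D_sum_code = indexed_partition_inD(2)[OF partition]
lemmas D_unique = indexed_partition_inD(3)[OF partition]

lemma D_words: "i < N \<Longrightarrow> x \<in> D i \<Longrightarrow> x \<in> words q N"
  using D_sum_code sum_code_words by blast

text \<open>The \<open>N\<close> neighbours of \<open>x\<close> with zero sum have mutual distance at most 2, so they lie in
  distinct cells; there are also \<open>N\<close> cells, so every cell is met.\<close>

lemma D_covers:
  assumes x: "x \<in> words q N" "x \<notin> sum_code q N 0" and i: "i < N"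
  obtains d where "d \<in> D i" "hdist x d \<le> 1"
proof -
  \<comment> \<open>Adding \<open>e\<close> to any one coordinate makes the sum zero;
    \<open>e < q\<close> because the sum of \<open>x\<close> is nonzero modulo
    \<open>q\<close>.\<close>
  define e where "e = q - sum_list x mod q"
  have e: "0 < e" "e < q"
    using x q mod_less_divisor[of q "sum_list x"] by (auto simp: sum_code_def e_def)
  have len: "length x = N"
    using x by (simp add: words_length)
  have "(sum_list x + e) mod q = (sum_list x mod q + e) mod q"
    by (simp add: mod_simps)
  also have "\<dots> = 0"
    using e q by (simp add: e_def)
  finally have sum0: "(sum_list x + e) mod q = 0" .
  have "bump q p e x \<in> sum_code q N 0" if "p < N" for p
    using sum_bump[of p x q e] that x q sum0 by (simp add: sum_code_def bump_words cong_def words_length)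
  then have "\<forall>p. \<exists>k. p < N \<longrightarrow> k < N \<and> bump q p e x \<in> D k"
    using D_ex by blast
  then obtain f where f: "\<And>p. p < N \<Longrightarrow> f p < N \<and> bump q p e x \<in> D (f p)"
    by metis
  have "inj_on f {..<N}"
  proof (rule inj_onI)
    fix p p'
    assume *: "p \<in> {..<N}" "p' \<in> {..<N}" "f p = f p'"
    have "hdist (bump q p e x) (bump q p' e x) \<le> hdist (bump q p e x) x + hdist x (bump q p' e x)"
      by (intro hdist_triangle) simp_all
    also have "\<dots> \<le> 2"
      using hdist_bump_le[of x q p e] hdist_bump_le[of x q p' e] hdist_commute[of x "bump q p e x"]
      by simp
    finally have "bump q p e x = bump q p' e x"
      using dist[of "f p" "bump q p e x" "bump q p' e x"] f[of p] f[of p'] * by fastforce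
    then show "p = p'"
      using bump_nth_neq[OF x(1), of p e] e * len
      by (auto simp: bump_def nth_list_update split: if_splits)
  qed
  moreover have "f ` {..<N} \<subseteq> {..<N}"
    using f by auto
  ultimately have "f ` {..<N} = {..<N}"
    by (intro endo_inj_surj) auto
  then obtain p where "p < N" "f p = i"
    using i by (metis imageE lessThan_iff)
  then show ?thesis
    using that f hdist_bump_le by metis
qed

text \<open>One step from \<open>d\<close> leaves the zero-sum code, and from there every cell is
  one step away. This supplies the close prefixes for codewords at distance exactly 3.\<close>

lemma D_adjacent_cells:
  assumes i: "i < N" "i' < N" and d: "d \<in> D i"
  obtains d' where "d' \<in> D i'" "hdist d d' \<le> 2"
proof -
  define x where "x = bump q 0 1 d"
  have dw: "d \<in> words q N" "sum_list d mod q = 0" "length d = N"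
    using D_sum_code[OF i(1) d] by (auto simp: sum_code_def words_length)
  have x: "x \<in> words q N" "x \<notin> sum_code q N 0"
    using dw q N sum_bump[of 0 d q 1] by (auto simp: x_def bump_words sum_code_def cong_def mod_Suc)
  then obtain d' where d': "d' \<in> D i'" "hdist x d' \<le> 1"
    using D_covers i(2) by blast
  have "hdist d d' \<le> hdist d x + hdist x d'"
    using dw x D_words[OF i(2) d'(1)] by (intro hdist_triangle) (auto simp: words_length)
  also have "\<dots> \<le> 2"
    using d' hdist_bump_le[of d q 0 1] by (simp add: x_def)
  finally show ?thesis
    using that d' by blast
qed

section \<open>Codes glued along the cells of the zero-sum code\<close>

text \<open>Three families are glued this way: the \<open>B i\<close> give \<open>S\<close>, their
  lengthenings give the perfect code, and cyclic rotations of \<open>B\<close> give the other codes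
  of the partition in (iii).\<close>

definition joined :: "(nat \<Rightarrow> nat list set) \<Rightarrow> nat list set" where
  "joined B = (\<Union>i<N. concat_code (D i) (B i))"

lemma joined_cases:
  assumes "w \<in> joined B"
  obtains i x y where "i < N" "x \<in> D i" "y \<in> B i" "w = x @ y"
  using assms by (auto simp: joined_def concat_code_def)

lemma append_joined_iff:
  assumes "x \<in> D i" "i < N"
  shows "x @ y \<in> joined B \<longleftrightarrow> y \<in> B i"
proof
  assume "x @ y \<in> joined B"
  then obtain i' x' y' where *: "i' < N" "x' \<in> D i'" "y' \<in> B i'" "x @ y = x' @ y'"
    by (rule joined_cases)
  then have "x = x'" "y = y'"
    using D_words assms by (metis append_eq_append_conv words_length)+
  then show "y \<in> B i"
    using * assms D_unique by metis
qed (use assms in \<open>auto simp: joined_def concat_code_def\<close>)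

lemma append_joined_sum_code:
  assumes "x @ y \<in> joined B" "length x = N"
  shows "x \<in> sum_code q N 0"
  using assms D_sum_code D_words by (metis append_eq_append_conv joined_cases words_length)

lemma joined_words:
  assumes "\<And>i. i < N \<Longrightarrow> B i \<subseteq> words q l"
  shows "joined B \<subseteq> words q (N + l)"
proof
  fix w
  assume "w \<in> joined B"
  then obtain i x y where "i < N" "x \<in> D i" "y \<in> B i" "w = x @ y"
    by (rule joined_cases)
  moreover from this have "x \<in> words q N" "y \<in> words q l"
    using assms D_words by blast+
  ultimately show "w \<in> words q (N + l)"
    by (simp add: words_append_iff words_length)
qed

text \<open>Within one cell a single factor already contributes 3. Across cells the bound splits as
  2 + 1: distinct zero-sum prefixes are never adjacent, and disjointness of the \<open>B i\<close>
  makes the suffixes differ.\<close>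

lemma joined_hdist:
  assumes B: "\<And>i. i < N \<Longrightarrow> B i \<subseteq> words q l" "disjoint_family_on B {..<N}"
    and Bdist: "\<And>i x y. i < N \<Longrightarrow> x \<in> B i \<Longrightarrow> y \<in> B i \<Longrightarrow> x \<noteq> y \<Longrightarrow> 3 \<le> hdist x y"
    and w: "w \<in> joined B" "w' \<in> joined B" "w \<noteq> w'"
  shows "3 \<le> hdist w w'"
proof -
  obtain i x y where 1: "i < N" "x \<in> D i" "y \<in> B i" "w = x @ y"
    using w(1) by (rule joined_cases)
  obtain i' x' y' where 2: "i' < N" "x' \<in> D i'" "y' \<in> B i'" "w' = x' @ y'"
    using w(2) by (rule joined_cases)
  have len: "length x = length x'" "length y = length y'"
    using 1 2 D_words B(1) by (metis words_length subsetD)+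
  have eq: "hdist w w' = hdist x x' + hdist y y'"
    using 1 2 len by (simp add: hdist_append)
  show ?thesis
  proof (cases "i = i'")
    case True
    then have "3 \<le> hdist x x' \<or> 3 \<le> hdist y y'"
      using 1 2 w(3) dist[of i x x'] Bdist[of i y y'] by auto
    then show ?thesis
      using eq by auto
  next
    case False
    have "x \<noteq> x'"
      using False 1 2 D_unique by metis
    then have "2 \<le> hdist x x'"
      using sum_code_hdist[of x q N 0 x'] D_sum_code 1 2 by force
    moreover have "y \<noteq> y'"
      using False 1 2 B(2) by (auto simp: disjoint_family_on_def)
    then have "1 \<le> hdist y y'"
      using hdist_eq_0_iff[OF len(2)] by (metis One_nat_def Suc_leI neq0_conv)
    ultimately show ?thesis
      using eq by simp
  qed
qed

lemma card_joined:
  assumes B: "\<And>i. i < N \<Longrightarrow> B i \<subseteq> words q l"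
    and card: "\<And>i. i < N \<Longrightarrow> card (D i) = a" "\<And>i. i < N \<Longrightarrow> card (B i) = b"
  shows "card (joined B) = N * (a * b)"
proof -
  let ?f = "\<lambda>(x, y). x @ y"
  have conc: "concat_code X Y = ?f ` (X \<times> Y)" for X Y
    by (auto simp: concat_code_def)
  have fin: "finite (D i)" "finite (B i)" if "i < N" for i
    using that B D_words finite_words finite_subset by (metis subsetI)+
  have "card (concat_code (D i) (B i)) = a * b" if i: "i < N" for i
  proof -
    have "inj_on ?f (D i \<times> B i)"
    proof (rule inj_onI, clarify)
      fix x y x' y'
      assume "x \<in> D i" "x' \<in> D i" "x @ y = x' @ y'"
      moreover from this have "length x = length x'"
        using D_words[OF i] by (metis words_length)
      ultimately show "x = x' \<and> y = y'"
        by simp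
    qed
    then show ?thesis
      using i card by (simp add: conc card_image card_cartesian_product)
  qed
  moreover have "card (joined B) = (\<Sum>i<N. card (concat_code (D i) (B i)))"
    unfolding joined_def
  proof (intro card_UN_disjoint ballI impI)
    fix i i'
    assume *: "i \<in> {..<N}" "i' \<in> {..<N}" "i \<noteq> i'"
    show "concat_code (D i) (B i) \<inter> concat_code (D i') (B i') = {}"
    proof (rule ccontr)
      assume "concat_code (D i) (B i) \<inter> concat_code (D i') (B i') \<noteq> {}"
      then obtain x y x' y' where "x \<in> D i" "x' \<in> D i'" "x @ y = x' @ y'"
        unfolding concat_code_def by auto
      then show False
        using * D_words D_unique by (metis append_eq_append_conv lessThan_iff words_length)
    qed
  qed (auto simp: conc fin)
  ultimately show ?thesis
    by simp
qed

text \<open>Take two adjacent suffixes and, from the cells they select, prefixes at distance at most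
  2. The total is at most 3, and \<open>joined_hdist\<close> gives the reverse inequality.\<close>

lemma joined_hdist_3:
  assumes B: "indexed_partition N B (words q l)" and l: "0 < l"
    and Bdist: "\<And>i x y. i < N \<Longrightarrow> x \<in> B i \<Longrightarrow> y \<in> B i \<Longrightarrow> x \<noteq> y \<Longrightarrow> 3 \<le> hdist x y"
    and D: "\<And>i. i < N \<Longrightarrow> D i \<noteq> {}"
  obtains w w' where "w \<in> joined B" "w' \<in> joined B" "w \<noteq> w'" "hdist w w' = 3"
proof -
  note BD = indexed_partition_inD[OF B]
  define y where "y = replicate l (0 :: nat)"
  define y' where "y' = bump q 0 1 y"
  have y: "y \<in> words q l"
    using q by (auto simp: y_def words_def)
  then have y': "y' \<in> words q l"
    using q by (simp add: y'_def bump_words)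
  have "y \<noteq> y'"
    using bump_nth_neq[OF y, of 0 1] l q by (auto simp: y'_def)
  obtain i i' where i: "i < N" "i' < N" "y \<in> B i" "y' \<in> B i'"
    using BD(1) y y' by meson
  obtain x where x: "x \<in> D i"
    using D i by blast
  obtain x' where x': "x' \<in> D i'" "hdist x x' \<le> 2"
    using D_adjacent_cells i x by metis
  have mem: "x @ y \<in> joined B" "x' @ y' \<in> joined B"
    using append_joined_iff x x' i by auto
  have len: "length x = length x'"
    using x x' i D_words by (metis words_length)
  then have "x @ y \<noteq> x' @ y'"
    using \<open>y \<noteq> y'\<close> by simp
  moreover have "hdist (x @ y) (x' @ y') = hdist x x' + hdist y y'"
    using len by (rule hdist_append)
  then have "hdist (x @ y) (x' @ y') \<le> 3"
    using x' hdist_bump_le[of y q 0 1] by (simp add: y'_def)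
  moreover have "3 \<le> hdist (x @ y) (x' @ y')"
  proof (rule joined_hdist)
    show "B i \<subseteq> words q l" if "i < N" for i
      using BD(2) that by blast
    show "disjoint_family_on B {..<N}"
      using B by (simp add: indexed_partition_def)
  qed (use Bdist mem \<open>x @ y \<noteq> x' @ y'\<close> in auto)
  ultimately show ?thesis
    using that mem by (metis le_antisym)
qed

text \<open>A zero-sum prefix fixes the index \<open>i\<close>, and the suffix is corrected into the
  perfect code \<open>C i\<close>. Otherwise the suffix fixes \<open>i\<close>, because the
  \<open>C i\<close> partition the space, and the prefix is corrected into
  \<open>D i\<close>.\<close>

lemma joined_one_perfect:
  assumes C: "indexed_partition N C (words q l)" and perf: "\<And>i. i < N \<Longrightarrow> one_perfect q l (C i)"
  shows "one_perfect q (N + l) (joined C)"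
proof (rule one_perfectI)
  note CD = indexed_partition_inD[OF C]
  have Cw: "C i \<subseteq> words q l" if "i < N" for i
    using CD(2) that by blast
  show "joined C \<subseteq> words q (N + l)"
    using Cw by (rule joined_words)
  show "3 \<le> hdist c c'" if "c \<in> joined C" "c' \<in> joined C" "c \<noteq> c'" for c c'
  proof (rule joined_hdist)
    show "disjoint_family_on C {..<N}"
      using C by (simp add: indexed_partition_def)
  qed (use that Cw one_perfect_hdist_ge[OF perf] in auto)
  show "\<exists>c\<in>joined C. hdist v c \<le> 1" if v: "v \<in> words q (N + l)" for v
  proof -
    obtain x y where xy: "x \<in> words q N" "y \<in> words q l" "v = x @ y"
      using v by (rule words_split)
    show ?thesis
    proof (cases "x \<in> sum_code q N 0")
      case True
      then obtain i where i: "i < N" "x \<in> D i"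
        using D_ex by blast
      then obtain c where "c \<in> C i" "hdist y c \<le> 1"
        using one_perfectD(2)[OF perf] xy by blast
      then have "x @ c \<in> joined C" "hdist v (x @ c) \<le> 1"
        using i xy by (auto simp: append_joined_iff hdist_append)
      then show ?thesis by blast
    next
      case False
      obtain i where i: "i < N" "y \<in> C i"
        using CD(1) xy by blast
      obtain d where d: "d \<in> D i" "hdist x d \<le> 1"
        using D_covers xy False i by metis
      moreover have "length x = length d"
        using xy D_words[OF i(1) d(1)] by (simp add: words_length)
      ultimately have "d @ y \<in> joined C" "hdist v (d @ y) \<le> 1"
        using i xy by (auto simp: append_joined_iff hdist_append)
      then show ?thesis by blast
    qed
  qed
qed

section \<open>Shortening and lengthening glued codes\<close>

text \<open>Position \<open>j\<close> of the second factor is position \<open>N + j\<close> of the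
  whole word, so shortening leaves the prefix intact, and the prefix alone selects the cell.\<close>

lemma shortened_joined:
  assumes C: "\<And>i. i < N \<Longrightarrow> C i \<subseteq> words q (Suc l)" and j: "j \<le> l"
    and B: "\<And>i. i < N \<Longrightarrow> shortened j a (C i) = B i"
  shows "shortened (N + j) a (joined C) = joined B"
proof -
  have joined: "joined C \<subseteq> words q (Suc (N + l))"
    using joined_words[of C "Suc l"] C by simp
  have ins: "ins (N + j) a (x @ y) = x @ ins j a y" if "length x = N" for x y
    using that by (simp add: ins_def)
  have B': "y \<in> B i \<longleftrightarrow> ins j a y \<in> C i" if "i < N" for i y
    using shortened_iff[OF C j] B that by blast
  have "w \<in> shortened (N + j) a (joined C) \<longleftrightarrow> w \<in> joined B" for w
  proof
    assume "w \<in> shortened (N + j) a (joined C)"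
    then have mem: "ins (N + j) a w \<in> joined C"
      using shortened_iff[OF joined] j by simp
    then have "length (ins (N + j) a w) = Suc (N + l)"
      using joined words_length by blast
    then have len: "length w = N + l"
      by (auto simp: ins_def)
    define x y where "x = take N w" and "y = drop N w"
    have w: "w = x @ y" "length x = N"
      using len by (auto simp: x_def y_def)
    then have mem': "x @ ins j a y \<in> joined C"
      using mem ins by simp
    then obtain i where "i < N" "x \<in> D i"
      using append_joined_sum_code w D_ex by blast
    then show "w \<in> joined B"
      using mem' w B' append_joined_iff by simp
  next
    assume "w \<in> joined B"
    then obtain i x y where "i < N" "x \<in> D i" "y \<in> B i" "w = x @ y"
      by (rule joined_cases)
    moreover from this have "length x = N"
      using D_words words_length by blast
    ultimately have "ins (N + j) a w \<in> joined C"
      using ins append_joined_iff B' by simp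
    then show "w \<in> shortened (N + j) a (joined C)"
      using shortened_iff[OF joined] j by simp
  qed
  then show ?thesis by blast
qed

text \<open>The fibres over neighbours of one fixed \<open>w\<^sub>0\<close> outside the zero-sum code: their mutual
  distance 2 is what makes the resulting codes disjoint.\<close>

lemma lengthened_cells:
  assumes B: "indexed_partition N B (words q l)"
    and C: "one_perfect q (Suc (N + l)) C" and j: "j \<le> N + l" and a: "a < q"
    and S: "shortened j a C = joined B"
  obtains E where "indexed_partition N E (words q (Suc l))"
    and "\<And>i. i < N \<Longrightarrow> one_perfect q (Suc l) (E i)"
    and "\<And>i. i < N \<Longrightarrow> shortened 0 a (E i) = B i"
proof -
  note BD = indexed_partition_inD[OF B]
  note CD = one_perfectD[OF C]
  have S_iff: "ins j a w \<in> C \<longleftrightarrow> w \<in> joined B" for w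
    using shortened_iff[OF CD(1)] S j by blast
  have insw: "ins j s (x @ y) \<in> words q (Suc (N + l))"
    if "s < q" "x \<in> words q N" "y \<in> words q l" for s x y
    using that by (intro ins_words) (auto simp: words_append_iff words_length)
  have hd: "hdist (ins j s (x @ y)) (ins j t (x' @ y')) = of_bool (s \<noteq> t) + hdist x x' + hdist y y'"
    if "x \<in> words q N" "y \<in> words q l" "x' \<in> words q N" "y' \<in> words q l" for s t x y x' y'
    using that by (simp add: hdist_ins words_length hdist_append)
  have Ccases: "\<exists>s x y. s < q \<and> x \<in> words q N \<and> y \<in> words q l \<and> c = ins j s (x @ y)"
    if c: "c \<in> C" for c
  proof -
    obtain s w where "s < q" "w \<in> words q (N + l)" "c = ins j s w"
      using words_ins_cases[of c q "N + l" j] c CD(1) j by blast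
    then show ?thesis
      by (metis words_split)
  qed
  have zero: "x \<in> sum_code q N 0"
    if c: "ins j s (x @ y) \<in> C" and xy: "x \<in> words q N" "y \<in> words q l" for s x y
  proof (rule ccontr)
    assume x: "x \<notin> sum_code q N 0"
    obtain k where k: "k < N" "y \<in> B k"
      using BD(1) xy by blast
    obtain d where d: "d \<in> D k" "hdist x d \<le> 1"
      using D_covers xy x k by metis
    have "ins j a (d @ y) \<in> C"
      using S_iff append_joined_iff d k by simp
    moreover have "hdist (ins j s (x @ y)) (ins j a (d @ y)) \<le> 2"
      using hd[of x y d y s a] xy d D_words[OF k(1)] by (simp split: if_splits)
    ultimately have "ins j s (x @ y) = ins j a (d @ y)"
      using one_perfect_hdist_ge[OF C c, of "ins j a (d @ y)"] by fastforce
    then have "hdist x d = 0"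
      using hd[of x y d y s a] xy d D_words[OF k(1)] by simp
    then have "x = d"
      using xy d D_words[OF k(1)] by (metis hdist_eq_0_iff words_length)
    then show False
      using x d D_sum_code[OF k(1)] by simp
  qed
  \<comment> \<open>The word 1 0 ... 0 serves as a concrete word with nonzero sum modulo
    \<open>q\<close>.\<close>
  define w0 where "w0 = bump q 0 1 (replicate N 0)"
  have w0: "w0 \<in> words q N" "w0 \<notin> sum_code q N 0"
  proof -
    have r: "replicate N 0 \<in> words q N"
      using q by (auto simp: words_def)
    then show "w0 \<in> words q N"
      using q by (simp add: w0_def bump_words)
    show "w0 \<notin> sum_code q N 0"
      using sum_bump[of 0 "replicate N 0" q 1] q N
      by (simp add: w0_def sum_code_def cong_def sum_list_replicate)
  qed
  have "\<forall>i. \<exists>d. i < N \<longrightarrow> d \<in> D i \<and> hdist w0 d \<le> 1"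
    using D_covers[OF w0] by blast
  then obtain d where d: "\<And>i. i < N \<Longrightarrow> d i \<in> D i \<and> hdist w0 (d i) \<le> 1"
    by metis
  have dw: "d i \<in> words q N" if "i < N" for i
    using D_words d that by blast
  \<comment> \<open>The inserted symbol moves from position \<open>j\<close> to the front, since
    \<open>j\<close> may lie inside the prefix that is being removed. This gives all cells the
    common shortening position 0.\<close>
  define E where "E i = {s # y |s y. s < q \<and> y \<in> words q l \<and> ins j s (d i @ y) \<in> C}" for i
  have E_words: "E i \<subseteq> words q (Suc l)" for i
    by (auto simp: E_def words_Cons_iff)
  have Cons_cases: "\<exists>s y. v = s # y \<and> s < q \<and> y \<in> words q l" if "v \<in> words q (Suc l)" for v
    using that by (cases v) (auto simp: words_def)
  show ?thesis
  proof
    show "one_perfect q (Suc l) (E i)" if i: "i < N" for i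
      unfolding one_perfect_def
    proof (intro conjI ballI)
      fix v
      assume "v \<in> words q (Suc l)"
      then obtain s y where v: "v = s # y" "s < q" "y \<in> words q l"
        using Cons_cases by blast
      let ?v = "ins j s (d i @ y)"
      have vw: "?v \<in> words q (Suc (N + l))"
        using insw v dw i by blast
      obtain c where c: "c \<in> C" "hdist ?v c \<le> 1"
        using CD(2) vw by blast
      obtain t x z where t: "t < q" "x \<in> words q N" "z \<in> words q l" "c = ins j t (x @ z)"
        using Ccases c by blast
      have le: "of_bool (s \<noteq> t) + hdist (d i) x + hdist y z \<le> 1"
        using c t hd v dw i by metis
      have "d i = x"
      proof (rule sum_code_hdist)
        show "d i \<in> sum_code q N 0"
          using D_sum_code d i by blast
        show "x \<in> sum_code q N 0"
          using zero c t by blast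
      qed (use le in simp)
      then have "t # z \<in> E i" "hdist v (t # z) \<le> 1"
        using c t le v by (auto simp: E_def)
      moreover have "u = t # z" if u: "u \<in> E i" "hdist v u \<le> 1" for u
      proof -
        obtain t' z' where u': "u = t' # z'" "t' < q" "z' \<in> words q l" "ins j t' (d i @ z') \<in> C"
          using u by (auto simp: E_def)
        have "hdist ?v (ins j t' (d i @ z')) \<le> 1"
          using hd[of "d i" y "d i" z' s t'] u u' v dw i by simp
        then have "ins j t' (d i @ z') = ins j t (d i @ z)"
          using CD(3)[OF vw u'(4) c(1)] c t \<open>d i = x\<close> by simp
        then have "of_bool (t' \<noteq> t) + hdist z' z = 0"
          using hd[of "d i" z' "d i" z t' t] u' t dw i by simp
        then show ?thesis
          using u' t by (simp add: hdist_eq_0_iff words_length split: if_splits)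
      qed
      ultimately show "\<exists>!c. c \<in> E i \<and> hdist v c \<le> 1"
        by blast
    qed (use E_words in blast)
    show "indexed_partition N E (words q (Suc l))"
    proof (rule indexed_partitionI)
      show "v \<in> words q (Suc l)" if "v \<in> E i" for i v
        using that E_words by blast
    next
      fix v
      assume "v \<in> words q (Suc l)"
      then obtain s y where v: "v = s # y" "s < q" "y \<in> words q l"
        using Cons_cases by blast
      obtain c where c: "c \<in> C" "hdist (ins j s (w0 @ y)) c \<le> 1"
        using CD(2) insw v w0 by blast
      obtain t x z where t: "t < q" "x \<in> words q N" "z \<in> words q l" "c = ins j t (x @ z)"
        using Ccases c by blast
      have x: "x \<in> sum_code q N 0"
        using zero c t by blast
      then obtain i where i: "i < N" "x \<in> D i"
        using D_ex by blast
      have le: "of_bool (s \<noteq> t) + hdist w0 x + hdist y z \<le> 1"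
        using c t hd v w0 by metis
      \<comment> \<open>The prefix of the covering codeword is zero-sum and \<open>w0\<close> is
        not, so the one permitted change occurs in the prefix; the symbol \<open>s\<close> and the
        suffix \<open>y\<close> survive unchanged.\<close>
      moreover have "hdist w0 x \<noteq> 0"
        using x w0 t by (auto simp: hdist_eq_0_iff words_length)
      ultimately have *: "s = t" "hdist y z = 0" "hdist w0 x = 1"
        by (auto simp: of_bool_def split: if_splits)
      have "y = z"
        using * v t by (simp add: hdist_eq_0_iff words_length)
      \<comment> \<open>Both \<open>x\<close> and \<open>d i\<close> are neighbours of
        \<open>w0\<close> in the same cell \<open>D i\<close>, whose distinct words are at distance
        at least 3.\<close>
      have "hdist x (d i) \<le> hdist x w0 + hdist w0 (d i)"
        using t w0 dw[OF i(1)] by (intro hdist_triangle) (auto simp: words_length)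
      also have "\<dots> \<le> 2"
        using * d[OF i(1)] hdist_commute[of x w0] t w0 by (simp add: words_length)
      finally have "x = d i"
        using dist[of i x "d i"] i d by fastforce
      then have "v \<in> E i"
        using c t v * \<open>y = z\<close> by (auto simp: E_def)
      then show "\<exists>i<N. v \<in> E i"
        using i by blast
    next
      fix i k v
      assume ik: "i < N" "k < N" "v \<in> E i" "v \<in> E k"
      then obtain s y where v: "v = s # y" "s < q" "y \<in> words q l"
        "ins j s (d i @ y) \<in> C" "ins j s (d k @ y) \<in> C"
        by (auto simp: E_def)
      have "hdist (ins j s (w0 @ y)) (ins j s (d r @ y)) \<le> 1" if "r < N" for r
        using hd[of w0 y "d r" y s s] d that v w0 dw by simp
      then have "ins j s (d i @ y) = ins j s (d k @ y)"
        using CD(3) insw v w0 ik by metis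
      then have "hdist (d i) (d k) = 0"
        using hd[of "d i" y "d k" y s s] v dw ik by simp
      then have "d i = d k"
        using dw[OF ik(1)] dw[OF ik(2)] by (simp add: hdist_eq_0_iff words_length)
      then show "i = k"
        using D_unique d ik by metis
    qed
    show "shortened 0 a (E i) = B i" if i: "i < N" for i
    proof -
      have "y \<in> shortened 0 a (E i) \<longleftrightarrow> y \<in> B i" for y
      proof -
        have "y \<in> shortened 0 a (E i) \<longleftrightarrow> a # y \<in> E i"
          using shortened_iff[OF E_words[of i], of 0 y a] by (simp add: ins_def)
        also have "\<dots> \<longleftrightarrow> y \<in> words q l \<and> d i @ y \<in> joined B"
          using a S_iff by (auto simp: E_def)
        also have "\<dots> \<longleftrightarrow> y \<in> B i"
          using append_joined_iff[of "d i" i y B] d[OF i] i BD(2)[OF i, of y] by auto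
        finally show ?thesis .
      qed
      then show ?thesis by blast
    qed
  qed
qed

text \<open>Rotating the cells of \<open>B\<close> splits (zero-sum words) \<open>\<times>\<close> (words) into \<open>N\<close> codes, and
  adding \<open>a\<close> to the first coordinate moves these to the words whose first part has sum \<open>a\<close>.\<close>

definition rotated :: "(nat \<Rightarrow> nat list set) \<Rightarrow> nat \<Rightarrow> nat list set" where
  "rotated B t = bump q 0 (t div N) ` joined (\<lambda>i. B ((i + t mod N) mod N))"

lemma bump_append: "length x = N \<Longrightarrow> bump q 0 e (x @ y) = bump q 0 e x @ y"
  using N by (simp add: bump_def nth_append list_update_append)

lemma rotate_partition:
  assumes "indexed_partition N B A"
  shows "indexed_partition N (\<lambda>i. B ((i + k) mod N)) A"
proof (rule indexed_partitionI)
  note BD = indexed_partition_inD[OF assms]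
  show "x \<in> A" if "i < N" "x \<in> B ((i + k) mod N)" for i x
    using that BD(2)[of "(i + k) mod N"] N by simp
  show "i = i'" if *: "i < N" "i' < N" "x \<in> B ((i + k) mod N)" "x \<in> B ((i' + k) mod N)" for i i' x
  proof -
    have "(i + k) mod N = (i' + k) mod N"
      using BD(3) * N by simp
    then have "[i = i'] (mod N)"
      using cong_add_rcancel_nat[of i k i' N] by (simp add: cong_def)
    then show ?thesis
      using * by (simp add: cong_def)
  qed
  show "\<exists>i<N. x \<in> B ((i + k) mod N)" if x: "x \<in> A" for x
  proof -
    obtain r where r: "r < N" "x \<in> B r"
      using BD(1) x by blast
    \<comment> \<open>This is \<open>r - k\<close> modulo \<open>N\<close>, written without negative
      numbers.\<close>
    define i where "i = (r + (N - k mod N)) mod N"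
    have "(i + k) mod N = (r + (N - k mod N) + k mod N) mod N"
      by (simp add: i_def mod_simps)
    also have "\<dots> = r"
    proof -
      have "N - k mod N + k mod N = N"
        using N by (simp add: less_imp_le)
      then show ?thesis
        using r by (simp only: add.assoc) simp
    qed
    finally show ?thesis
      using r N by (intro exI[of _ i]) (simp add: i_def)
  qed
qed

text \<open>The index \<open>t\<close> encodes the pair (\<open>t div N\<close>,
  \<open>t mod N\<close>) of shift and rotation. A word determines the shift as the sum of its
  prefix; undoing the shift reveals the cell of \<open>D\<close>, and comparing that cell with the
  cell of the suffix in \<open>B\<close> reveals the rotation.\<close>

lemma rotated_partition:
  assumes B: "indexed_partition N B (words q l)"
  shows "indexed_partition (q * N) (rotated B) (words q (N + l))"
proof (rule indexed_partitionI)
  note BD = indexed_partition_inD[OF B]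
  note rot = rotate_partition[OF B]
  have joined_w: "joined (\<lambda>i. B ((i + k) mod N)) \<subseteq> words q (N + l)" for k
    using indexed_partition_inD(2)[OF rot] by (intro joined_words) blast
  show "w \<in> words q (N + l)" if "w \<in> rotated B t" for t w
    using that joined_w bump_words q by (force simp: rotated_def)
  have decomp: "\<exists>i x y. i < N \<and> x \<in> D i \<and> y \<in> B ((i + t mod N) mod N) \<and> w = bump q 0 (t div N) x @ y"
    if w: "w \<in> rotated B t" for w t
  proof -
    obtain u where u: "u \<in> joined (\<lambda>i. B ((i + t mod N) mod N))" "w = bump q 0 (t div N) u"
      using w by (auto simp: rotated_def)
    then obtain i x y where "i < N" "x \<in> D i" "y \<in> B ((i + t mod N) mod N)" "u = x @ y"
      by (auto elim: joined_cases)
    then show ?thesis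
      using u bump_append D_words words_length by metis
  qed
  have sum: "sum_list (bump q 0 e x) mod q = e mod q" if "i < N" "x \<in> D i" for i x e
  proof -
    have x: "x \<in> words q N" "sum_list x mod q = 0"
      using D_sum_code that by (auto simp: sum_code_def)
    have "sum_list (bump q 0 e x) mod q = (sum_list x mod q + e) mod q"
      using sum_bump[of 0 x q e] x(1) N by (simp add: cong_def words_length mod_simps)
    then show ?thesis
      using x by simp
  qed
  show "t = t'" if t: "t < q * N" "t' < q * N" and w: "w \<in> rotated B t" "w \<in> rotated B t'" for t t' w
  proof -
    obtain i x y where 1: "i < N" "x \<in> D i" "y \<in> B ((i + t mod N) mod N)"
      "w = bump q 0 (t div N) x @ y"
      using decomp w(1) by blast
    obtain i' x' y' where 2: "i' < N" "x' \<in> D i'" "y' \<in> B ((i' + t' mod N) mod N)"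
      "w = bump q 0 (t' div N) x' @ y'"
      using decomp w(2) by blast
    have xw: "x \<in> words q N" "x' \<in> words q N"
      using 1 2 D_words by auto
    then have eq: "bump q 0 (t div N) x = bump q 0 (t' div N) x'" "y = y'"
      using 1 2 by (auto simp: words_length)
    have "t div N < q" "t' div N < q"
      using t by (simp_all add: less_mult_imp_div_less)
    then have tdiv: "t div N = t' div N"
      using sum[OF 1(1,2), of "t div N"] sum[OF 2(1,2), of "t' div N"] eq by simp
    then have "x = x'"
      using eq inj_on_bump[OF N] xw by (auto dest: inj_onD)
    then have "i = i'"
      using 1 2 D_unique by metis
    then have "(i + t mod N) mod N = (i + t' mod N) mod N"
      using 1 2 eq BD(3) N by (metis mod_less_divisor)
    then have "[i + t mod N = i + t' mod N] (mod N)"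
      by (simp add: cong_def)
    then have "[t mod N = t' mod N] (mod N)"
      by (simp only: cong_add_lcancel_nat)
    then have "t mod N = t' mod N"
      by (simp add: cong_def)
    then show ?thesis
      using tdiv by (metis div_mult_mod_eq)
  qed
  show "\<exists>t<q * N. w \<in> rotated B t" if w: "w \<in> words q (N + l)" for w
  proof -
    obtain u y where uy: "u \<in> words q N" "y \<in> words q l" "w = u @ y"
      using w by (rule words_split)
    define a where "a = sum_list u mod q"
    have a: "a < q"
      using q by (simp add: a_def)
    \<comment> \<open>Subtracting \<open>a\<close> is adding \<open>q - a\<close>; for
      \<open>a = 0\<close> this adds \<open>q\<close>, which \<open>bump\<close> reduces
      away.\<close>
    define x where "x = bump q 0 (q - a) u"
    have xw: "x \<in> words q N"
      using uy q by (simp add: x_def bump_words)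
    have "sum_list x mod q = (sum_list u + (q - a)) mod q"
      using sum_bump[of 0 u q "q - a"] uy N by (simp add: x_def cong_def words_length)
    also have "\<dots> = (sum_list u mod q + (q - a)) mod q"
      by (simp add: mod_simps)
    also have "\<dots> = 0"
      using a by (simp flip: a_def)
    finally have "x \<in> sum_code q N 0"
      using xw by (simp add: sum_code_def)
    then obtain i where i: "i < N" "x \<in> D i"
      using D_ex by blast
    have bx: "bump q 0 a x = u"
      unfolding x_def using uy a N by (intro bump_cancel) (auto simp: cong_def)
    \<comment> \<open>Index and offset exchange roles here: the known cell \<open>i\<close> is the
      offset of the rotated partition, and the index found is the required rotation
      \<open>k\<close>.\<close>
    obtain k where k: "k < N" "y \<in> B ((k + i) mod N)"
      using indexed_partition_inD(1)[OF rot] uy by blast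
    define t where "t = a * N + k"
    have t: "t div N = a" "t mod N = k"
      using k by (auto simp: t_def)
    have "x @ y \<in> joined (\<lambda>i. B ((i + t mod N) mod N))"
      using append_joined_iff[OF i(2,1)] k t by (simp add: add.commute)
    moreover have "bump q 0 (t div N) (x @ y) = w"
      using bump_append xw bx t uy by (simp add: words_length)
    ultimately have "w \<in> rotated B t"
      unfolding rotated_def by blast
    moreover have "t < q * N"
    proof -
      have "t < (a + 1) * N"
        using k by (simp add: t_def)
      also have "\<dots> \<le> q * N"
        using a by (intro mult_right_mono) auto
      finally show ?thesis .
    qed
    ultimately show ?thesis by blast
  qed
qed

text \<open>Even a shift by 0 reduces the first symbol modulo \<open>q\<close>; it is the identity
  here because that symbol lies in a nonempty prefix over the alphabet.\<close>

lemma rotated_0: "rotated B 0 = joined B"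
proof -
  have "joined (\<lambda>i. B (i mod N)) = joined B"
    by (auto simp: joined_def)
  moreover have "bump q 0 0 w = w" if w: "w \<in> joined B" for w
  proof -
    obtain i x y where *: "i < N" "x \<in> D i" "w = x @ y"
      using w by (rule joined_cases)
    then have "x \<in> words q N"
      using D_words by blast
    then have "x ! 0 < q" "length x = N"
      using N by (auto simp: words_nth_less words_length)
    then show ?thesis
      using * by (simp add: bump_append) (simp add: bump_def)
  qed
  ultimately show ?thesis
    by (simp add: rotated_def)
qed

end

section \<open>Transport of code parameters and proof of the theorem\<close>

lemma code_image_bump:
  assumes "code q n M d C" "p < n" "0 < q"
  shows "code q n M d (bump q p e ` C)"
proof -
  have C: "C \<subseteq> words q n" "card C = M" "\<And>x y. x \<in> C \<Longrightarrow> y \<in> C \<Longrightarrow> x \<noteq> y \<Longrightarrow> d \<le> hdist x y"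
    using assms(1) by (auto simp: code_def code_ge_def)
  obtain x y where xy: "x \<in> C" "y \<in> C" "x \<noteq> y" "hdist x y = d"
    using assms(1) by (auto simp: code_def)
  have inj: "inj_on (bump q p e) C"
    using inj_on_bump[OF assms(2)] C(1) inj_on_subset by blast
  have hd: "hdist (bump q p e x) (bump q p e y) = hdist x y" if "x \<in> C" "y \<in> C" for x y
    using hdist_bump_bump C(1) that assms(2) by blast
  have "bump q p e ` C \<subseteq> words q n"
    using C(1) bump_words assms(3) by blast
  moreover have "card (bump q p e ` C) = M"
    using inj C(2) by (simp add: card_image)
  moreover have "d \<le> hdist u v" if "u \<in> bump q p e ` C" "v \<in> bump q p e ` C" "u \<noteq> v" for u v
    using that C(3) hd by force
  moreover have "\<exists>u\<in>bump q p e ` C. \<exists>v\<in>bump q p e ` C. u \<noteq> v \<and> hdist u v = d"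
    using xy hd inj by (metis imageI inj_onD)
  ultimately show ?thesis
    unfolding code_def code_ge_def by blast
qed

theorem theorem3:
  fixes q m n n' n'' :: nat
    and B D :: "nat \<Rightarrow> nat list set"
    and S :: "nat list set"
  assumes q: "q \<ge> 2" and m: "m \<ge> 2"
    and n: "n = (q ^ m - 1) div (q - 1)"
    and n': "n' = (q ^ (m - 1) - 1) div (q - 1)"
    and n'': "n'' = q ^ (m - 1)"
    and B_partition: "indexed_partition n'' B (words q (n' - 1))"
    and B_code: "\<And>i. i < n'' \<Longrightarrow> code_ge q (n' - 1) (q ^ (n' - 1 - (m - 1))) 3 (B i)"
    and D_partition: "indexed_partition n'' D (sum_code q n'' 0)"
    and D_code: "\<And>i. i < n'' \<Longrightarrow> code_ge q n'' (q ^ (n'' - m)) 3 (D i)"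
    and S: "S = (\<Union>i<q ^ (m - 1). concat_code (D i) (B i))"
  shows
    "code q (n - 1) (q ^ (n - 1 - m)) 3 S \<and>
     ((\<exists>C j a. j < n \<and> a < q \<and>
          code q n (q ^ (n - m)) 3 C \<and> one_perfect q n C \<and> shortened j a C = S) \<longleftrightarrow>
      (\<exists>C j a. j < n' \<and> a < q \<and>
          (\<forall>i<n''. code q n' (q ^ (n' - (m - 1))) 3 (C i) \<and> one_perfect q n' (C i) \<and>
                   shortened j a (C i) = B i) \<and>
          indexed_partition n'' C (words q n'))) \<and>
     (\<exists>P. indexed_partition (q ^ m) P (words q (n - 1)) \<and>
          (\<forall>i<q ^ m. code q (n - 1) (q ^ (n - 1 - m)) 3 (P i)) \<and>
          (\<exists>i<q ^ m. P i = S))"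
proof -
  define l where "l = n' - 1"
  have n'_sum: "n' = (\<Sum>i<m - 1. q ^ i)" and n_sum: "n = (\<Sum>i<m. q ^ i)"
    using n n' geometric_div(1)[OF q] by auto
  have "m = Suc (m - 1)"
    using m by simp
  \<comment> \<open>As geometric sums, \<open>n\<close> and \<open>n'\<close> differ by the last
    term \<open>q ^ (m - 1)\<close>.\<close>
  then have nn: "n = n' + n''"
    using n'_sum n_sum n'' by (metis sum.lessThan_Suc)
  have "n' \<noteq> 0"
  proof
    assume "n' = 0"
    then have "q ^ (m - 1) = 1"
      using geometric_div(2)[OF q, of "m - 1"] unfolding n'_sum[symmetric] by simp
    then show False
      using q m by simp
  qed
  then have n'_l: "n' = Suc l" and n_l: "n = Suc (n'' + l)"
    using nn by (auto simp: l_def)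
  have N: "0 < n''"
    using n'' q by simp
  have Bcode: "B i \<subseteq> words q l" "card (B i) = q ^ (l - (m - 1))"
    "\<And>x y. x \<in> B i \<Longrightarrow> y \<in> B i \<Longrightarrow> x \<noteq> y \<Longrightarrow> 3 \<le> hdist x y" if "i < n''" for i
    using B_code[OF that] by (auto simp: code_ge_def l_def)
  have Dcard: "card (D i) = q ^ (n'' - m)" if "i < n''" for i
    using D_code[OF that] by (simp add: code_ge_def)
  interpret zero_sum_partition q n'' D
    using q N D_partition D_code by unfold_locales (auto simp: code_ge_def)
  have Bpart: "indexed_partition n'' B (words q l)"
    using B_partition by (simp add: l_def)
  have S_joined: "S = joined B"
    using S unfolding n''[symmetric] by (simp add: joined_def)
  \<comment> \<open>Counting the partition compares exponents and yields
    \<open>m - 1 \<le> l\<close>, so the subtraction in the size of \<open>B i\<close> is not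
    truncated. In particular \<open>l > 0\<close>: the degenerate case \<open>m = 2\<close>, where
    \<open>l = 0\<close>, cannot satisfy the hypotheses.\<close>
  have "q ^ l = card (\<Union>i<n''. B i)"
    using Bpart by (simp add: indexed_partition_def card_words)
  also have "\<dots> = (\<Sum>i<n''. card (B i))"
    using Bpart finite_subset[OF Bcode(1) finite_words]
    by (intro card_UN_disjoint) (auto simp: indexed_partition_def disjoint_family_on_def)
  also have "\<dots> = q ^ (m - 1 + (l - (m - 1)))"
    using Bcode(2) by (simp add: n'' power_add)
  finally have "l = m - 1 + (l - (m - 1))"
    using q by simp
  then have ml: "m - 1 \<le> l" "0 < l"
    using m by auto
  have "m \<le> n''"
    using power_gt_expt[of q "m - 1"] q m by (simp add: n'')
  have expo: "(m - 1) + ((n'' - m) + (l - (m - 1))) = n - 1 - m"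
    using ml \<open>m \<le> n''\<close> m n_l by simp
  \<comment> \<open>Stated for an arbitrary family because (i) applies it to \<open>B\<close> and
    (iii) to each rotation of \<open>B\<close>.\<close>
  have joined_code: "code q (n - 1) (q ^ (n - 1 - m)) 3 (joined B')"
    if part: "indexed_partition n'' B' (words q l)"
      and card: "\<And>i. i < n'' \<Longrightarrow> card (B' i) = q ^ (l - (m - 1))"
      and Bdist: "\<And>i x y. i < n'' \<Longrightarrow> x \<in> B' i \<Longrightarrow> y \<in> B' i \<Longrightarrow> x \<noteq> y \<Longrightarrow> 3 \<le> hdist x y"
    for B'
  proof -
    have B': "B' i \<subseteq> words q l" if "i < n''" for i
      using indexed_partition_inD(2)[OF part] that by blast
    have disj: "disjoint_family_on B' {..<n''}"
      using part by (simp add: indexed_partition_def)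
    have "card (joined B') = n'' * (q ^ (n'' - m) * q ^ (l - (m - 1)))"
      using B' Dcard card by (rule card_joined)
    also have "\<dots> = q ^ (n - 1 - m)"
      unfolding expo[symmetric] by (simp only: power_add n'')
    finally have c: "card (joined B') = q ^ (n - 1 - m)" .
    have D_ne: "D i \<noteq> {}" if "i < n''" for i
      using Dcard[OF that] q by auto
    obtain w w' where "w \<in> joined B'" "w' \<in> joined B'" "w \<noteq> w'" "hdist w w' = 3"
      using part ml(2) Bdist D_ne by (rule joined_hdist_3)
    moreover have "3 \<le> hdist u v" if "u \<in> joined B'" "v \<in> joined B'" "u \<noteq> v" for u v
      using B' disj Bdist that by (rule joined_hdist)
    moreover have "joined B' \<subseteq> words q (n - 1)"
      using joined_words[of B' l] B' n_l by simp
    ultimately show ?thesis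
      using c unfolding code_def code_ge_def by blast
  qed
  have "code q (n - 1) (q ^ (n - 1 - m)) 3 S"
    unfolding S_joined using Bpart Bcode by (intro joined_code) auto
  moreover have "(\<exists>C j a. j < n \<and> a < q \<and>
          code q n (q ^ (n - m)) 3 C \<and> one_perfect q n C \<and> shortened j a C = S) \<longleftrightarrow>
      (\<exists>C j a. j < n' \<and> a < q \<and>
          (\<forall>i<n''. code q n' (q ^ (n' - (m - 1))) 3 (C i) \<and> one_perfect q n' (C i) \<and>
                   shortened j a (C i) = B i) \<and>
          indexed_partition n'' C (words q n'))" (is "?L \<longleftrightarrow> ?R")
  proof
    assume ?L
    then obtain C j a where C: "j < n" "a < q" "one_perfect q n C" "shortened j a C = S"
      by blast
    then obtain E where E: "indexed_partition n'' E (words q n')"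
      "\<And>i. i < n'' \<Longrightarrow> one_perfect q n' (E i)" "\<And>i. i < n'' \<Longrightarrow> shortened 0 a (E i) = B i"
      using lengthened_cells[OF Bpart, of C j a] n_l n'_l S_joined by auto
    have "2 \<le> n'"
      using ml n'_l by simp
    then have "\<forall>i<n''. code q n' (q ^ (n' - (m - 1))) 3 (E i) \<and> one_perfect q n' (E i) \<and>
                   shortened 0 a (E i) = B i"
      using E code_of_one_perfect[OF q n'] by blast
    then show ?R
      using E(1) C(2) n'_l by blast
  next
    assume ?R
    then obtain C j a where C: "j < n'" "a < q" "indexed_partition n'' C (words q n')"
      "\<And>i. i < n'' \<Longrightarrow> one_perfect q n' (C i)" "\<And>i. i < n'' \<Longrightarrow> shortened j a (C i) = B i"
      by blast
    have perf: "one_perfect q n (joined C)"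
      using joined_one_perfect[OF C(3,4)] nn by (simp add: add.commute)
    moreover have "code q n (q ^ (n - m)) 3 (joined C)"
      using perf ml n_l by (intro code_of_one_perfect q n) auto
    moreover have "shortened (n'' + j) a (joined C) = S"
      unfolding S_joined
    proof (rule shortened_joined)
      show "C i \<subseteq> words q (Suc l)" if "i < n''" for i
        using one_perfectD(1)[OF C(4)[OF that]] n'_l by simp
    qed (use C n'_l in auto)
    moreover have "n'' + j < n"
      using C(1) nn by simp
    ultimately show ?L
      using C(2) by blast
  qed
  moreover have "\<exists>P. indexed_partition (q ^ m) P (words q (n - 1)) \<and>
          (\<forall>i<q ^ m. code q (n - 1) (q ^ (n - 1 - m)) 3 (P i)) \<and>
          (\<exists>i<q ^ m. P i = S)"
  proof (intro exI conjI allI impI)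
    have qm: "q ^ m = q * n''"
      using m n'' by (metis \<open>m = Suc (m - 1)\<close> power_Suc)
    show "indexed_partition (q ^ m) (rotated B) (words q (n - 1))"
      using rotated_partition[OF Bpart] qm n_l by simp
    show "code q (n - 1) (q ^ (n - 1 - m)) 3 (rotated B t)" for t
      unfolding rotated_def
    proof (intro code_image_bump joined_code)
      show "indexed_partition n'' (\<lambda>i. B ((i + t mod n'') mod n'')) (words q l)"
        using Bpart by (rule rotate_partition)
      show "3 \<le> hdist x y"
        if "x \<in> B ((i + t mod n'') mod n'')" "y \<in> B ((i + t mod n'') mod n'')" "x \<noteq> y" for i x y
        using Bcode(3)[of "(i + t mod n'') mod n''"] that N by simp
    qed (use Bcode(2) N n_l q in auto)
    show "rotated B 0 = S"
      by (simp add: rotated_0 S_joined)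
    show "0 < q ^ m"
      using q by simp
  qed
  ultimately show ?thesis
    by blast
qed

end
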